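(* Let $m,n\ge1$, let $\mathcal G=\{I,X\}$ be a group of order two with identity $I$ and $X^2=I$, and let $P\in\mathcal G^{m\times n}$ be a target gate pattern. Let $M\in\mathrm{GF}(2)^{m\times n}$ be the matrix with $M_{ij}=1$ if $P_{ij}=X$ and $M_{ij}=0$ if $P_{ij}=I$. Then the minimum number of addressing layers needed to realize $P$ equals the rank of $M$ over $\mathrm{GF}(2)$.
   Context: An addressing layer on an $m\times n$ array is specified by $u\in\{0,1\}^m$, $v\in\{0,1\}^n$ and $G\in\mathcal G$; it is the matrix $(uv^\top)\cdot G\in\mathcal G^{m\times n}$ whose $(i,j)$ entry is $G$ if $u_iv_j=1$ and the identity $I$ if $u_iv_j=0$. A pattern $P$ is realized by $k$ addressing layers if $P$ is the entrywise product (in the group $\mathcal G$) of $k$ addressing layers. *)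

theory Defs
  imports "HOL-Analysis.Analysis" "HOL-Algebra.Coset" "HOL-Library.Z2"
begin

text \<open>
  An \<open>m \<times> n\<close> array of gates is a value of type \<^typ>\<open>'g ^ 'n ^ 'm\<close> whose entries lie in
  \<open>carrier \<G>\<close>; \<open>m = CARD('m)\<close> and \<open>n = CARD('n)\<close> are arbitrary positive integers.
  The type \<^typ>\<open>bit\<close> serves both as the two-element set \<open>{0,1}\<close> and as the field \<open>GF(2)\<close>.
\<close>

definition layer_matrix ::
    "('g, 'z) monoid_scheme \<Rightarrow> bit ^ 'm \<Rightarrow> bit ^ 'n \<Rightarrow> 'g \<Rightarrow> 'g ^ 'n ^ 'm" where
  "layer_matrix \<G> u v g = (\<chi> i j. if u $ i * v $ j = 1 then g else \<one>\<^bsub>\<G>\<^esub>)"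

definition addressing_layer :: "('g, 'z) monoid_scheme \<Rightarrow> 'g ^ 'n ^ 'm \<Rightarrow> bool" where
  "addressing_layer \<G> L \<longleftrightarrow> (\<exists>u v. \<exists>g\<in>carrier \<G>. L = layer_matrix \<G> u v g)"

text \<open>The product is taken in list order, so that it makes sense in a non-commutative group as
  well; the empty product is the all-identity pattern.\<close>

definition entrywise_product ::
    "('g, 'z) monoid_scheme \<Rightarrow> ('g ^ 'n ^ 'm) list \<Rightarrow> 'g ^ 'n ^ 'm" where
  "entrywise_product \<G> Ls = (\<chi> i j. foldr (\<lambda>L g. L $ i $ j \<otimes>\<^bsub>\<G>\<^esub> g) Ls \<one>\<^bsub>\<G>\<^esub>)"

definition realized_by :: "('g, 'z) monoid_scheme \<Rightarrow> 'g ^ 'n ^ 'm \<Rightarrow> nat \<Rightarrow> bool" where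
  "realized_by \<G> P k \<longleftrightarrow>
    (\<exists>Ls. length Ls = k \<and> (\<forall>L\<in>set Ls. addressing_layer \<G> L) \<and> P = entrywise_product \<G> Ls)"

text \<open>Only meaningful when some \<open>k\<close> with \<open>realized_by \<G> P k\<close> exists.\<close>

definition min_layers :: "('g, 'z) monoid_scheme \<Rightarrow> 'g ^ 'n ^ 'm \<Rightarrow> nat" where
  "min_layers \<G> P = (LEAST k. realized_by \<G> P k)"

end

(* Over GF(2), the layers are exactly the images of the dyads (rank-one outer products) under the
   isomorphism GF(2) -> G sending 1 to X, which turns sums into entrywise products.  The number of
   layers needed is therefore the least number of dyads summing to M, and this is the rank. *)
theory Submission
  imports Defs
begin

definition outer :: "'a::semiring_0 ^ 'm \<Rightarrow> 'a ^ 'n \<Rightarrow> 'a ^ 'n ^ 'm" where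
  "outer u v = (\<chi> i j. u $ i * v $ j)"

lemma outer_nth [simp]: "outer u v $ i $ j = u $ i * v $ j"
  by (simp add: outer_def)

text \<open>Row \<open>i\<close> of a dyad \<open>outer u v\<close> is the multiple
  \<open>u $ i *s v\<close> of its second factor, so the rows of a sum of dyads are combinations of
  the second factors alone.\<close>

lemma row_in_span_outer:
  fixes ps :: "(('a::field ^ 'm) \<times> ('a ^ 'n)) list"
  shows "(\<Sum>(u, v)\<leftarrow>ps. outer u v) $ i \<in> vec.span (snd ` set ps)"
proof (induction ps)
  case Nil
  then show ?case by simp
next
  case (Cons p ps)
  have "outer (fst p) (snd p) $ i = fst p $ i *s snd p"
    by (simp add: vec_eq_iff)
  then have "outer (fst p) (snd p) $ i \<in> vec.span (snd ` set (p # ps))"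
    by (simp add: vec.span_scale vec.span_base)
  moreover have "(\<Sum>(u, v)\<leftarrow>ps. outer u v) $ i \<in> vec.span (snd ` set (p # ps))"
    using Cons.IH vec.span_mono[of "snd ` set ps" "snd ` set (p # ps)"] by auto
  ultimately show ?case
    by (simp add: case_prod_unfold vec.span_add)
qed

text \<open>The lower bound on the number of layers: the row space is spanned by the second factors,
  and coinciding factors can only make this spanning set smaller than the list.\<close>

lemma rank_sum_outer_le:
  fixes ps :: "(('a::field ^ 'm) \<times> ('a ^ 'n)) list"
  shows "rank (\<Sum>(u, v)\<leftarrow>ps. outer u v) \<le> length ps"
proof -
  have "rank (\<Sum>(u, v)\<leftarrow>ps. outer u v) \<le> card (snd ` set ps)"
    unfolding row_rank_def_gen
    by (rule vec.dim_le_card) (auto simp: rows_def row_def row_in_span_outer)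
  also have "\<dots> \<le> length ps"
    by (metis card_length length_map list.set_map)
  finally show ?thesis .
qed

text \<open>The upper bound: expanding every row in a basis of the row space writes the matrix as
  one dyad per basis vector.\<close>

lemma rank_factorization:
  fixes A :: "'a::field ^ 'n ^ 'm"
  obtains ps :: "(('a ^ 'm) \<times> ('a ^ 'n)) list"
  where "length ps = rank A" "A = (\<Sum>(u, v)\<leftarrow>ps. outer u v)"
proof -
  obtain B where B: "vec.independent B" "rows A \<subseteq> vec.span B" "card B = rank A"
    unfolding row_rank_def_gen by (metis vec.basis_exists)
  have "finite B"
    using B(1) by (rule vec.finiteI_independent)
  have "\<exists>c. A $ i = (\<Sum>b\<in>B. c b *s b)" for i
  proof -
    have "A $ i \<in> vec.span B"
      using B(2) by (auto simp: rows_def row_def)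
    then show ?thesis
      by (auto simp: vec.span_finite[OF \<open>finite B\<close>])
  qed
  then obtain c where c: "\<And>i. A $ i = (\<Sum>b\<in>B. c i b *s b)"
    by metis
  \<comment> \<open>Listing \<open>B\<close> without repetition preserves both the sum over
    \<open>B\<close> and the count \<open>card B\<close>.\<close>
  obtain bs where bs: "set bs = B" "distinct bs"
    using finite_distinct_list[OF \<open>finite B\<close>] by blast
  \<comment> \<open>The coefficients of a fixed \<open>b\<close>, collected over all rows, form the
    column vector paired with \<open>b\<close>.\<close>
  have "A = (\<Sum>b\<in>B. outer (\<chi> i. c i b) b)"
    by (simp add: vec_eq_iff c sum_component)
  also have "\<dots> = (\<Sum>(u, v)\<leftarrow>map (\<lambda>b. (\<chi> i. c i b, b)) bs. outer u v)"
    using bs by (simp add: sum_list_distinct_conv_sum_set o_def)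
  finally have "A = (\<Sum>(u, v)\<leftarrow>map (\<lambda>b. (\<chi> i. c i b, b)) bs. outer u v)" .
  moreover have "length (map (\<lambda>b. (\<chi> i. c i b, b)) bs) = rank A"
    using bs B(3) distinct_card by fastforce
  ultimately show thesis
    using that by blast
qed

text \<open>The gate of a layer may always be taken to be \<open>X\<close>: a layer with the
  identity gate is the all-identity pattern, which the choice \<open>u = 0\<close> also
  produces.\<close>

lemma addressing_layer_iff_outer:
  assumes "carrier \<G> = {\<one>\<^bsub>\<G>\<^esub>, X}"
  shows "addressing_layer \<G> L \<longleftrightarrow>
    (\<exists>u v. L = (\<chi> i j. if outer u v $ i $ j = (1::bit) then X else \<one>\<^bsub>\<G>\<^esub>))"
proof
  assume "addressing_layer \<G> L"
  then obtain u v g where L: "L = layer_matrix \<G> u v g" and "g = \<one>\<^bsub>\<G>\<^esub> \<or> g = X"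
    using assms by (auto simp: addressing_layer_def)
  from this(2) show "\<exists>u v. L = (\<chi> i j. if outer u v $ i $ j = (1::bit) then X else \<one>\<^bsub>\<G>\<^esub>)"
  proof
    assume "g = \<one>\<^bsub>\<G>\<^esub>"
    then have "L = (\<chi> i j. if outer 0 v $ i $ j = (1::bit) then X else \<one>\<^bsub>\<G>\<^esub>)"
      by (simp add: L layer_matrix_def vec_eq_iff)
    then show ?thesis by blast
  next
    assume "g = X"
    then have "L = (\<chi> i j. if outer u v $ i $ j = (1::bit) then X else \<one>\<^bsub>\<G>\<^esub>)"
      by (simp only: L layer_matrix_def outer_nth)
    then show ?thesis by blast
  qed
next
  assume "\<exists>u v. L = (\<chi> i j. if outer u v $ i $ j = (1::bit) then X else \<one>\<^bsub>\<G>\<^esub>)"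
  then obtain u v where "L = layer_matrix \<G> u v X"
    by (auto simp only: layer_matrix_def outer_nth)
  then show "addressing_layer \<G> L"
    using assms by (auto simp: addressing_layer_def)
qed

text \<open>Sending 1 to \<open>X\<close> and 0 to the identity is a homomorphism from the additive
  group of GF(2), because \<open>X \<otimes> X = \<one>\<close> matches 1 + 1 = 0. Induction extends
  this to lists.\<close>

lemma entrywise_product_of_bit:
  fixes \<G> (structure)
  assumes "group \<G>" "X \<in> carrier \<G>" "X \<otimes> X = \<one>"
  shows "entrywise_product \<G> (map (\<lambda>A. \<chi> i j. if A $ i $ j = (1::bit) then X else \<one>) As) =
    (\<chi> i j. if sum_list As $ i $ j = 1 then X else \<one>)"
proof (induction As)
  case Nil
  then show ?case by (simp add: entrywise_product_def)
next
  case (Cons A As)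
  interpret group \<G> by fact
  have add: "(if a + b = 1 then X else \<one>) = (if a = 1 then X else \<one>) \<otimes> (if b = 1 then X else \<one>)"
    for a b :: bit
    using assms(2,3) by (cases a; cases b) auto
  from Cons show ?case
    by (simp add: entrywise_product_def vec_eq_iff add assms(2,3))
qed

text \<open>This turns the question about gates into one of linear algebra. Since \<open>X\<close>
  differs from the identity, the translation of matrices into patterns is injective, so an equation
  between patterns pulls back to GF(2).\<close>

lemma realized_by_iff_sum_outer:
  fixes P :: "'g ^ 'n ^ 'm" and M :: "bit ^ 'n ^ 'm"
  assumes "group \<G>" and carrier: "carrier \<G> = {\<one>\<^bsub>\<G>\<^esub>, X}"
    and "X \<noteq> \<one>\<^bsub>\<G>\<^esub>" and "X \<otimes>\<^bsub>\<G>\<^esub> X = \<one>\<^bsub>\<G>\<^esub>"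
    and P: "P = (\<chi> i j. if M $ i $ j = 1 then X else \<one>\<^bsub>\<G>\<^esub>)"
  shows "realized_by \<G> P k \<longleftrightarrow> (\<exists>ps. length ps = k \<and> M = (\<Sum>(u, v)\<leftarrow>ps. outer u v))"
proof -
  define gates :: "bit ^ 'n ^ 'm \<Rightarrow> 'g ^ 'n ^ 'm"
    where "gates A = (\<chi> i j. if A $ i $ j = 1 then X else \<one>\<^bsub>\<G>\<^esub>)" for A
  have gates_eq_iff: "gates A = gates B \<longleftrightarrow> A = B" for A B
  proof
    assume eq: "gates A = gates B"
    show "A = B"
    proof (intro vec_eq_iff[THEN iffD2] allI)
      fix i j
      have "gates A $ i $ j = gates B $ i $ j" by (simp add: eq)
      then show "A $ i $ j = B $ i $ j"
        using \<open>X \<noteq> \<one>\<^bsub>\<G>\<^esub>\<close> by (cases "A $ i $ j"; cases "B $ i $ j") (auto simp: gates_def)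
    qed
  qed simp
  have layers: "(\<forall>L\<in>set Ls. addressing_layer \<G> L) \<longleftrightarrow>
      (\<exists>ps. Ls = map (\<lambda>(u, v). gates (outer u v)) ps)" for Ls :: "('g ^ 'n ^ 'm) list"
  proof -
    have "addressing_layer \<G> L \<longleftrightarrow> L \<in> range (\<lambda>(u, v). gates (outer u v))" for L :: "'g ^ 'n ^ 'm"
      by (auto simp only: addressing_layer_iff_outer[OF carrier] gates_def image_iff split_paired_Ex case_prod_conv UNIV_I bex_UNIV)
    then show ?thesis
      \<comment> \<open>A list whose members all lie in the range of a function is the image of a
        list, by choosing preimages memberwise.\<close>
      by (metis (no_types, lifting) ex_map_conv rangeE rangeI)
  qed
  have product: "entrywise_product \<G> (map (\<lambda>(u, v). gates (outer u v)) ps) =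
      gates (\<Sum>(u, v)\<leftarrow>ps. outer u v)" for ps
    using entrywise_product_of_bit[OF assms(1) _ assms(4), of "map (\<lambda>(u, v). outer u v) ps"] carrier
    by (simp add: gates_def[abs_def] o_def case_prod_unfold)
  have "P = gates M"
    by (simp only: P gates_def)
  show ?thesis
    unfolding realized_by_def \<open>P = gates M\<close> layers
    by (metis (no_types, lifting) length_map product gates_eq_iff)
qed

theorem mainTheorem3:
  fixes \<G> :: "('g, 'z) monoid_scheme" and X :: 'g
    and P :: "'g ^ 'n ^ 'm" and M :: "bit ^ 'n ^ 'm"
  assumes "group \<G>"
    and "Coset.order \<G> = 2"
    and "carrier \<G> = {\<one>\<^bsub>\<G>\<^esub>, X}"
    and "X \<otimes>\<^bsub>\<G>\<^esub> X = \<one>\<^bsub>\<G>\<^esub>"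
    and "\<And>i j. P $ i $ j \<in> carrier \<G>"
    and "\<And>i j. P $ i $ j = X \<Longrightarrow> M $ i $ j = 1"
    and "\<And>i j. P $ i $ j = \<one>\<^bsub>\<G>\<^esub> \<Longrightarrow> M $ i $ j = 0"
  shows "(\<exists>k. realized_by \<G> P k) \<and> min_layers \<G> P = rank M"
proof -
  \<comment> \<open>If \<open>X\<close> were the identity, the carrier would have a single element,
    contradicting order two.\<close>
  have "X \<noteq> \<one>\<^bsub>\<G>\<^esub>"
    using assms(2,3) by (auto simp: Coset.order_def)
  have "P $ i $ j = (if M $ i $ j = 1 then X else \<one>\<^bsub>\<G>\<^esub>)" for i j
    using assms(3) assms(5-7)[of i j] by auto
  then have "P = (\<chi> i j. if M $ i $ j = 1 then X else \<one>\<^bsub>\<G>\<^esub>)"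
    by (simp add: vec_eq_iff)
  note realized_iff = realized_by_iff_sum_outer[OF assms(1,3) \<open>X \<noteq> \<one>\<^bsub>\<G>\<^esub>\<close> assms(4) this]
  \<comment> \<open>Besides showing that the value \<open>rank M\<close> is attained, this makes the
    \<open>LEAST\<close> in \<open>min_layers\<close> meaningful.\<close>
  have realized: "realized_by \<G> P (rank M)"
    unfolding realized_iff using rank_factorization[of M] by metis
  moreover have "rank M \<le> k" if "realized_by \<G> P k" for k
    using that rank_sum_outer_le by (auto simp: realized_iff)
  ultimately have "min_layers \<G> P = rank M"
    unfolding min_layers_def by (rule Least_equality)
  with realized show ?thesis by blast
qed

end
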